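(* Let $N\colon\mathbb{B}^L\to\mathbb{B}^L$ be the reduced Boolean Delta-Notch system over a graph $\mathcal{G}$ as in the context. A subspace $A\subseteq\mathbb{B}^L$ is a trap space for $N$ if and only if $A=x[I]$ for some fixed point $x$ of $N$ and some $I\subseteq C$ such that for every $i\in S(I)\cap(C\setminus I)$ there exists $j\in S(i)\cap(C\setminus I)$ with $x_j=0$.
   Context: Let $L\ge 1$ and let $\mathcal{G}$ be an undirected connected graph without loops on the vertex set $C=\{1,\dots,L\}$. For $i\in C$ let $S(i)$ be the set of neighbours of $i$ in $\mathcal{G}$, and for $A\subseteq C$ let $S(A)=\bigcup_{i\in A}S(i)$. $\mathbb{B}=\{0,1\}$. The reduced Boolean Delta-Notch system is $N\colon\mathbb{B}^L\to\mathbb{B}^L$, $N_i(n)=\bigvee_{j\in S(i)}(1-n_j)$ (empty disjunction $=0$). The asynchronous dynamics $AD_N$ is the directed graph on $\mathbb{B}^L$ with an edge from $x$ to the state obtained from $x$ by flipping coordinate $i$ whenever $N_i(x)\neq x_i$. For $x\in\mathbb{B}^L$ and $I\subseteq C$, the subspace $x[I]$ is $\{y\in\mathbb{B}^L: y_i=x_i \ \forall i\notin I\}$. A trap space is a subspace $A$ such that every successor in $AD_N$ of a state in $A$ lies in $A$. A fixed point is $x$ with $N(x)=x$. *)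

theory Defs
  imports "HOL-Library.FuncSet" "Graph_Theory.Pair_Digraph" "Graph_Theory.Digraph_Component"
begin

text \<open>
  An undirected graph without loops is a \<open>pair_graph\<close>, i.e. a finite loop-free digraph with
  symmetric arc set. The Boolean values 0 and 1 are \<open>False\<close> and \<open>True\<close>, and the state space consists of the
  Boolean functions on the vertex set \<open>C\<close> (extensional, so that equality of states is
  coordinatewise equality on \<open>C\<close>).
\<close>

type_synonym 'a state = "'a \<Rightarrow> bool"

definition nbs :: "'a pair_pre_digraph \<Rightarrow> 'a \<Rightarrow> 'a set" where
  "nbs G i = {j. (i, j) \<in> parcs G}"

definition Nbs :: "'a pair_pre_digraph \<Rightarrow> 'a set \<Rightarrow> 'a set" where
  "Nbs G A = (\<Union>i\<in>A. nbs G i)"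

definition states :: "'a pair_pre_digraph \<Rightarrow> 'a state set" where
  "states G = pverts G \<rightarrow>\<^sub>E (UNIV :: bool set)"

definition delta_notch :: "'a pair_pre_digraph \<Rightarrow> 'a state \<Rightarrow> 'a state" where
  "delta_notch G n = (\<lambda>i\<in>pverts G. \<exists>j\<in>nbs G i. \<not> n j)"

definition async_dynamics :: "'a pair_pre_digraph \<Rightarrow> ('a state \<Rightarrow> 'a state) \<Rightarrow> 'a state pair_pre_digraph" where
  "async_dynamics G F =
     \<lparr> pverts = states G,
       parcs = {(x, x(i := \<not> x i)) | x i. x \<in> states G \<and> i \<in> pverts G \<and> F x i \<noteq> x i} \<rparr>"

definition subspace_at :: "'a pair_pre_digraph \<Rightarrow> 'a state \<Rightarrow> 'a set \<Rightarrow> 'a state set" where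
  "subspace_at G x I = {y \<in> states G. \<forall>i \<in> pverts G - I. y i = x i}"

definition is_subspace :: "'a pair_pre_digraph \<Rightarrow> 'a state set \<Rightarrow> bool" where
  "is_subspace G A \<longleftrightarrow> (\<exists>x \<in> states G. \<exists>I \<subseteq> pverts G. A = subspace_at G x I)"

definition trap_space :: "'a pair_pre_digraph \<Rightarrow> ('a state \<Rightarrow> 'a state) \<Rightarrow> 'a state set \<Rightarrow> bool" where
  "trap_space G F A \<longleftrightarrow>
     is_subspace G A \<and> (\<forall>x \<in> A. \<forall>y. (x, y) \<in> parcs (async_dynamics G F) \<longrightarrow> y \<in> A)"

definition fixed_point :: "'a pair_pre_digraph \<Rightarrow> ('a state \<Rightarrow> 'a state) \<Rightarrow> 'a state \<Rightarrow> bool" where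
  "fixed_point G F x \<longleftrightarrow> x \<in> states G \<and> F x = x"

end

theory Submission
  imports Defs
begin

text \<open>
  The zero sets of fixed points are exactly the maximal independent sets of the graph. In a trap
  space \<open>z[I]\<close>, the frozen zeros (outside \<open>I\<close>) form an independent set, and every frozen one has a
  frozen zero as neighbour; hence any maximal independent set containing the frozen zeros
  contains no frozen one, and is the zero set of a fixed point lying in \<open>z[I]\<close>. Conversely, the
  condition on the boundary of \<open>I\<close> makes every frozen coordinate insensitive to the free ones.
\<close>

text \<open>Used to exchange the base point of a trap space for a fixed point found inside
  it.\<close>

lemma subspace_at_eq_if_mem:
  assumes "x \<in> subspace_at G z I"
  shows "subspace_at G x I = subspace_at G z I"
  using assms by (auto simp: subspace_at_def)

lemma (in pair_graph) nbs_sym: "j \<in> nbs G i \<longleftrightarrow> i \<in> nbs G j"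
  unfolding nbs_def by (blast intro: arcs_symmetric)

lemma (in pair_graph) nbs_in_verts: "j \<in> nbs G i \<Longrightarrow> j \<in> pverts G"
  by (auto simp: nbs_def dest: in_arcsD2)

lemma (in pair_graph) not_in_nbs_self: "i \<notin> nbs G i"
  by (auto simp: nbs_def dest: no_loops)

text \<open>An edge can leave the subspace only by flipping a coordinate outside \<open>I\<close>.
  At a state \<open>y\<close> of the subspace such a coordinate has value \<open>x i\<close>, so the
  flip is available exactly when \<open>F y i\<close> differs from \<open>x i\<close>.\<close>

lemma trap_space_subspace_at_iff:
  assumes "x \<in> states G" "I \<subseteq> pverts G"
  shows "trap_space G F (subspace_at G x I) \<longleftrightarrow>
    (\<forall>y \<in> subspace_at G x I. \<forall>i \<in> pverts G - I. F y i = x i)"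
proof
  assume trap: "trap_space G F (subspace_at G x I)"
  show "\<forall>y \<in> subspace_at G x I. \<forall>i \<in> pverts G - I. F y i = x i"
  proof (intro ballI, rule ccontr)
    fix y i
    assume y: "y \<in> subspace_at G x I" and i: "i \<in> pverts G - I" and neq: "F y i \<noteq> x i"
    then have yi: "y i = x i" and "y \<in> states G"
      by (auto simp: subspace_at_def)
    with neq i have "(y, y(i := \<not> y i)) \<in> parcs (async_dynamics G F)"
      unfolding async_dynamics_def pair_pre_digraph.simps mem_Collect_eq by (metis DiffD1)
    with trap y have "y(i := \<not> y i) \<in> subspace_at G x I"
      by (auto simp: trap_space_def)
    with i have "(y(i := \<not> y i)) i = x i"
      unfolding subspace_at_def by blast
    with yi show False
      by simp
  qed
next
  assume *: "\<forall>y \<in> subspace_at G x I. \<forall>i \<in> pverts G - I. F y i = x i"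
  have "y(i := \<not> y i) \<in> subspace_at G x I"
    if "y \<in> subspace_at G x I" "i \<in> pverts G" "F y i \<noteq> y i" for y i
  proof -
    have "i \<in> I"
      using that * by (auto simp: subspace_at_def)
    with that show ?thesis
      by (auto simp: subspace_at_def states_def PiE_def extensional_def)
  qed
  with assms show "trap_space G F (subspace_at G x I)"
    unfolding trap_space_def is_subspace_def async_dynamics_def by auto
qed

lemma (in pair_graph) ex_fixed_point_superset_zeros:
  assumes "Z \<subseteq> pverts G" "\<forall>i\<in>Z. nbs G i \<inter> Z = {}"
  shows "\<exists>x. fixed_point G (delta_notch G) x \<and> (\<forall>i\<in>Z. \<not> x i)"
proof -
  define F where "F = {M. M \<subseteq> pverts G \<and> (\<forall>i\<in>M. nbs G i \<inter> M = {})}"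
  have "finite F"
    unfolding F_def by (rule finite_subset[of _ "Pow (pverts G)"]) auto
  moreover have "Z \<in> F"
    using assms by (simp add: F_def)
  ultimately obtain M where "M \<in> F" and ZM: "Z \<subseteq> M" and max: "\<forall>K\<in>F. M \<subseteq> K \<longrightarrow> M = K"
    using finite_has_maximal2[of F Z] by blast
  then have M: "M \<subseteq> pverts G" "\<forall>i\<in>M. nbs G i \<inter> M = {}"
    by (simp_all add: F_def)
  have dom: "nbs G i \<inter> M \<noteq> {}" if "i \<in> pverts G" "i \<notin> M" for i
  proof
    assume "nbs G i \<inter> M = {}"
    \<comment> \<open>Symmetry of adjacency and the absence of loops keep the enlarged set
      independent.\<close>
    with that M have "insert i M \<in> F"
      unfolding F_def using nbs_sym not_in_nbs_self by blast
    with max that(2) show False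
      by blast
  qed
  define x where "x = (\<lambda>i\<in>pverts G. i \<notin> M)"
  \<comment> \<open>On \<open>M\<close> independence gives the value 0, on the other vertices
    \<open>dom\<close> gives 1, and outside \<open>pverts G\<close> both sides are
    \<open>undefined\<close>.\<close>
  have "delta_notch G x i = x i" for i
    using M dom[of i] nbs_in_verts by (auto simp: delta_notch_def x_def)
  then have "fixed_point G (delta_notch G) x"
    by (auto simp: fixed_point_def states_def x_def)
  moreover have "\<forall>i\<in>Z. \<not> x i"
    using ZM assms(1) by (auto simp: x_def)
  ultimately show ?thesis
    by blast
qed

lemma (in pair_graph) trap_space_if_fixed_point:
  assumes fp: "fixed_point G (delta_notch G) x" and I: "I \<subseteq> pverts G"
    and bd: "\<forall>i \<in> Nbs G I \<inter> (pverts G - I). \<exists>j \<in> nbs G i \<inter> (pverts G - I). \<not> x j"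
  shows "trap_space G (delta_notch G) (subspace_at G x I)"
proof -
  have x: "x \<in> states G" "delta_notch G x = x"
    using fp by (auto simp: fixed_point_def)
  have "delta_notch G y i = x i" if y: "y \<in> subspace_at G x I" and i: "i \<in> pverts G - I" for y i
  proof -
    have eq: "y j = x j" if "j \<in> pverts G - I" for j
      using y that by (auto simp: subspace_at_def)
    have "delta_notch G y i = delta_notch G x i"
    proof (cases "i \<in> Nbs G I")
      case True
      \<comment> \<open>A single frozen zero among the neighbours makes the disjunction true,
        whatever the free coordinates are.\<close>
      then obtain j where "j \<in> nbs G i" "\<not> x j" "\<not> y j"
        using bd i eq by blast
      then show ?thesis
        using i by (auto simp: delta_notch_def)
    next
      case False
      \<comment> \<open>By symmetry, a neighbour of \<open>i\<close> in \<open>I\<close> would put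
        \<open>i\<close> into \<open>Nbs G I\<close>.\<close>
      then have "nbs G i \<subseteq> pverts G - I"
        unfolding Nbs_def using nbs_sym nbs_in_verts by blast
      then show ?thesis
        using i eq by (auto simp: delta_notch_def)
    qed
    with x show ?thesis
      by simp
  qed
  with x(1) I show ?thesis
    by (simp add: trap_space_subspace_at_iff)
qed

lemma (in pair_graph) fixed_point_if_trap_space:
  assumes z: "z \<in> states G" and I: "I \<subseteq> pverts G"
    and trap: "trap_space G (delta_notch G) (subspace_at G z I)"
  obtains x where "fixed_point G (delta_notch G) x" "x \<in> subspace_at G z I"
    "\<forall>i \<in> Nbs G I \<inter> (pverts G - I). \<exists>j \<in> nbs G i \<inter> (pverts G - I). \<not> x j"
proof -
  have frozen: "delta_notch G y i = z i" if "y \<in> subspace_at G z I" "i \<in> pverts G - I" for y i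
    using trap that z I by (simp add: trap_space_subspace_at_iff)
  \<comment> \<open>The two extreme states of the subspace, with all free coordinates 0 or all 1. At
    a frozen zero, \<open>y\<^sub>0\<close> shows that every neighbour is a frozen one; at a frozen
    one, \<open>y\<^sub>1\<close> shows that some neighbour is a frozen zero.\<close>
  define y\<^sub>0 where "y\<^sub>0 = (\<lambda>i\<in>pverts G. i \<notin> I \<and> z i)"
  define y\<^sub>1 where "y\<^sub>1 = (\<lambda>i\<in>pverts G. i \<in> I \<or> z i)"
  have y: "y\<^sub>0 \<in> subspace_at G z I" "y\<^sub>1 \<in> subspace_at G z I"
    by (auto simp: subspace_at_def states_def y\<^sub>0_def y\<^sub>1_def)
  have zero: "j \<notin> I \<and> z j" if "i \<in> pverts G - I" "\<not> z i" "j \<in> nbs G i" for i j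
    using frozen[OF y(1) that(1)] that nbs_in_verts[OF that(3)]
    by (auto simp: delta_notch_def y\<^sub>0_def)
  have one: "\<exists>j \<in> nbs G i \<inter> (pverts G - I). \<not> z j" if "i \<in> pverts G - I" "z i" for i
    using frozen[OF y(2) that(1)] that nbs_in_verts
    by (auto simp: delta_notch_def y\<^sub>1_def split: if_splits)
  obtain x where fp: "fixed_point G (delta_notch G) x"
    and xz: "\<forall>i \<in> {i \<in> pverts G - I. \<not> z i}. \<not> x i"
    using ex_fixed_point_superset_zeros[of "{i \<in> pverts G - I. \<not> z i}"] zero by blast
  have x: "x \<in> states G" "delta_notch G x = x"
    using fp by (auto simp: fixed_point_def)
  have eq: "x i = z i" if i: "i \<in> pverts G - I" for i
  proof (cases "z i")
    case True
    then have "\<exists>j \<in> nbs G i. \<not> x j"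
      using one i xz by blast
    then have "delta_notch G x i"
      using i by (auto simp: delta_notch_def)
    with x True show ?thesis
      by simp
  next
    case False
    with xz i show ?thesis
      by auto
  qed
  show thesis
  proof (rule that)
    show "fixed_point G (delta_notch G) x"
      by (fact fp)
    show "x \<in> subspace_at G z I"
      using x eq by (auto simp: subspace_at_def)
    show "\<forall>i \<in> Nbs G I \<inter> (pverts G - I). \<exists>j \<in> nbs G i \<inter> (pverts G - I). \<not> x j"
    proof
      fix i assume i: "i \<in> Nbs G I \<inter> (pverts G - I)"
      \<comment> \<open>All neighbours of a frozen zero are frozen, whereas \<open>i\<close> has a
        neighbour in \<open>I\<close>.\<close>
      then have "z i"
        unfolding Nbs_def using zero nbs_sym by blast
      with i one eq show "\<exists>j \<in> nbs G i \<inter> (pverts G - I). \<not> x j"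
        by blast
    qed
  qed
qed

theorem theorem7:
  fixes L :: nat and C :: "nat set" and G :: "nat pair_pre_digraph" and A :: "nat state set"
  assumes "L \<ge> 1"
    and "C = {1..L}"
    and "pverts G = C"
    and "pair_graph G"
    and "Digraph_Component.connected (with_proj G)"
    and "is_subspace G A"
  shows "trap_space G (delta_notch G) A \<longleftrightarrow>
    (\<exists>x I. fixed_point G (delta_notch G) x \<and> I \<subseteq> C \<and> A = subspace_at G x I \<and>
       (\<forall>i \<in> Nbs G I \<inter> (C - I). \<exists>j \<in> nbs G i \<inter> (C - I). \<not> x j))"
proof -
  interpret pair_graph G
    by (fact assms(4))
  show ?thesis
  proof
    assume trap: "trap_space G (delta_notch G) A"
    obtain z I where z: "z \<in> states G" "I \<subseteq> pverts G" "A = subspace_at G z I"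
      using assms(6) by (auto simp: is_subspace_def)
    with trap obtain x where "fixed_point G (delta_notch G) x" "x \<in> subspace_at G z I"
      "\<forall>i \<in> Nbs G I \<inter> (pverts G - I). \<exists>j \<in> nbs G i \<inter> (pverts G - I). \<not> x j"
      using fixed_point_if_trap_space by blast
    moreover from this(2) z(3) have "A = subspace_at G x I"
      by (simp add: subspace_at_eq_if_mem)
    ultimately show "\<exists>x I. fixed_point G (delta_notch G) x \<and> I \<subseteq> C \<and> A = subspace_at G x I \<and>
       (\<forall>i \<in> Nbs G I \<inter> (C - I). \<exists>j \<in> nbs G i \<inter> (C - I). \<not> x j)"
      using z(2) unfolding assms(3) by (intro exI conjI)
  next
    assume "\<exists>x I. fixed_point G (delta_notch G) x \<and> I \<subseteq> C \<and> A = subspace_at G x I \<and>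
       (\<forall>i \<in> Nbs G I \<inter> (C - I). \<exists>j \<in> nbs G i \<inter> (C - I). \<not> x j)"
    then show "trap_space G (delta_notch G) A"
      unfolding assms(3)[symmetric] by (elim exE conjE) (simp add: trap_space_if_fixed_point)
  qed
qed

end
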